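(* Let $a,q\in\mathbb C$ with $a\neq 0,1$ and $|q|>1$. Then the Al-Salam-Carlitz polynomials $U_n^{(a)}(x;q^{-1})$ are the unique polynomials (up to a multiplicative constant) satisfying the property of orthogonality given by $$\int_a^1 U_n^{(a)}(x;q^{-1})\,U_m^{(a)}(x;q^{-1})\,(q^{-1}x;q^{-1})_\infty(q^{-1}x/a;q^{-1})_\infty\,d_{q^{-1}}x$$ $$=(-a)^n(1-q^{-1})(q^{-1};q^{-1})_n(q^{-1};q^{-1})_\infty(a;q^{-1})_\infty(q^{-1}/a;q^{-1})_\infty\,q^{-\binom n2}\,\delta_{m,n}.$$
   Context: Here $n,m$ are nonnegative integers and $\delta_{m,n}$ is the Kronecker delta. For $z,r\in\mathbb C$: $(z;r)_0=1$, $(z;r)_n=\prod_{k=0}^{n-1}(1-zr^k)$, and, for $|r|<1$, $(z;r)_\infty=\prod_{k=0}^\infty(1-zr^k)$. For $a,r\in\mathbb C\setminus\{0\}$, $|r|<1$, the Al-Salam-Carlitz polynomials with base $r$ are $$U_n^{(a)}(x;r)=(-a)^nr^{\binom n2}\sum_{k=0}^n\frac{(r^{-n};r)_k\,(x^{-1};r)_k}{(r;r)_k}\,\frac{r^kx^k}{a^k},$$ where $(x^{-1};r)_k\,x^k$ is the polynomial $\prod_{j=0}^{k-1}(x-r^j)$; $U_n^{(a)}(x;r)$ has degree $n$ in $x$. For $0<|r|<1$ and complex $a,b$ the Jackson integral with base $r$ is $\int_a^bf(x)\,d_rx=\int_0^bf(x)\,d_rx-\int_0^af(x)\,d_rx$,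 where $\int_0^af(x)\,d_rx=a(1-r)\sum_{n=0}^\infty f(ar^n)r^n$. Both are used here with $r=q^{-1}$.
   Formalization: Uniqueness is stated among sequences with deg P_n = n that are orthogonal and have at least one nonzero square norm; this is automatic unless a is an integer power of q, where the integral vanishes on all polynomials and uniqueness fails. *)

theory Defs
  imports "HOL-Analysis.Analysis" "HOL-Computational_Algebra.Polynomial"
begin

definition qpoch :: "complex \<Rightarrow> complex \<Rightarrow> nat \<Rightarrow> complex" where
  "qpoch z r n = (\<Prod>k<n. 1 - z * r ^ k)"

definition qpoch_inf :: "complex \<Rightarrow> complex \<Rightarrow> complex" where
  "qpoch_inf z r = (\<Prod>k. 1 - z * r ^ k)"

text \<open>The Al-Salam--Carlitz polynomial \<open>U\<^sub>n\<close> with parameter \<open>a\<close> and base \<open>r\<close>.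
  The inner product of linear factors \<open>x - r^j\<close> is the polynomial that the literature
  writes as \<open>(x^-1; r)_k x^k\<close>.\<close>

definition al_salam_carlitz :: "complex \<Rightarrow> complex \<Rightarrow> nat \<Rightarrow> complex poly" where
  "al_salam_carlitz a r n =
     smult ((- a) ^ n * r ^ (n choose 2))
       (\<Sum>k\<le>n. smult (qpoch (r powi (- int n)) r k / qpoch r r k * (r ^ k / a ^ k))
                  (\<Prod>j<k. [:- (r ^ j), 1:]))"

definition jackson_integral0 :: "complex \<Rightarrow> complex \<Rightarrow> (complex \<Rightarrow> complex) \<Rightarrow> complex" where
  "jackson_integral0 r a f = a * (1 - r) * (\<Sum>n. f (a * r ^ n) * r ^ n)"

definition jackson_integral ::
    "complex \<Rightarrow> complex \<Rightarrow> complex \<Rightarrow> (complex \<Rightarrow> complex) \<Rightarrow> complex" where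
  "jackson_integral r a b f = jackson_integral0 r b f - jackson_integral0 r a f"

text \<open>Jackson integral from \<open>a\<close> to \<open>1\<close> of \<open>f g\<close> against the
  Al-Salam--Carlitz weight.\<close>

definition asc_pairing ::
    "complex \<Rightarrow> complex \<Rightarrow> complex poly \<Rightarrow> complex poly \<Rightarrow> complex" where
  "asc_pairing a r f g =
     jackson_integral r a 1
       (\<lambda>x. poly f x * poly g x * qpoch_inf (r * x) r * qpoch_inf (r * x / a) r)"

text \<open>Orthogonality of a polynomial sequence \<open>P 0, P 1, \<dots>\<close> with \<open>P n\<close> of exact degree \<open>n\<close>
  (\<open>P n \<noteq> 0\<close> matters only for \<open>n = 0\<close>, because \<open>degree 0 = 0\<close>). The last clause excludes the
  degenerate relation in which all products, diagonal ones included, integrate to zero; it is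
  weaker than the usual requirement that every \<open>P n\<close> have non-zero square norm. It cannot be
  dropped in a uniqueness statement: if \<open>a\<close> is an integer power of \<open>r\<close>, the pairing
  is identically zero.\<close>

definition asc_orthogonal :: "complex \<Rightarrow> complex \<Rightarrow> (nat \<Rightarrow> complex poly) \<Rightarrow> bool" where
  "asc_orthogonal a r P \<longleftrightarrow>
     (\<forall>n. P n \<noteq> 0 \<and> degree (P n) = n) \<and>
     (\<forall>m n. m \<noteq> n \<longrightarrow> asc_pairing a r (P n) (P m) = 0) \<and>
     (\<exists>n. asc_pairing a r (P n) (P n) \<noteq> 0)"

end

theory Submission
  imports Defs
begin

text \<open>Put \<open>r = q^-1\<close> and \<open>w(x) = (rx;r)_inf (rx/a;r)_inf\<close>. Since
  \<open>w(x/r) = (1 - x)(1 - x/a) w(x)\<close> vanishes at \<open>1\<close> and \<open>a\<close>, integrating the \<open>r\<close>-derivative of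
  \<open>f(x) w(x/r)\<close> gives zero for every \<open>f\<close> continuous at \<open>0\<close>. With \<open>f(x) = U_n(x) U_m(x/r)\<close>,
  the lowering relation for \<open>U_n\<close> and the raising relation for \<open>U_m\<close> turn this into a recursion
  that lowers \<open>n\<close> and \<open>m\<close> simultaneously, so only the total mass is left to compute.
  With \<open>f(x)\<close> the product of \<open>x/r - a r^j\<close> over \<open>j < N\<close>, it says that the
  integral of the product of \<open>x - a r^j\<close> over \<open>j < N\<close> does not depend on \<open>N\<close>. For \<open>N = 0\<close> it is
  the total mass; as \<open>N\<close> grows, every lattice point except \<open>x = 1\<close> stops contributing, and
  the limit is the claimed product. Uniqueness holds because all square norms share the factor
  \<open>(a;r)_inf (r/a;r)_inf\<close>, which cannot vanish if any orthogonality relation is non-degenerate.\<close>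

section \<open>Expansion coefficients and elementary bounds\<close>

definition asc_integral :: "complex \<Rightarrow> complex \<Rightarrow> (complex \<Rightarrow> complex) \<Rightarrow> complex" where
  "asc_integral a r f =
     jackson_integral r a 1 (\<lambda>x. f x * qpoch_inf (r * x) r * qpoch_inf (r * x / a) r)"

text \<open>Coefficient of \<open>U_n\<close> in the Newton basis of products of
  \<open>x - r ^ j\<close> over \<open>j < k\<close>, prefactor included. It is also meaningful for
  \<open>k > n\<close>, where it vanishes (\<open>asc_coeff_eq_0\<close>).\<close>

definition asc_coeff :: "complex \<Rightarrow> complex \<Rightarrow> nat \<Rightarrow> nat \<Rightarrow> complex" where
  "asc_coeff a r n k =
     (- a) ^ n * r ^ (n choose 2) * (qpoch (r powi (- int n)) r k / qpoch r r k * (r ^ k / a ^ k))"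

lemma poly_al_salam_carlitz:
  "poly (al_salam_carlitz a r n) x = (\<Sum>k\<le>n. asc_coeff a r n k * (\<Prod>j<k. x - r ^ j))"
  by (simp add: al_salam_carlitz_def asc_coeff_def poly_sum poly_prod sum_distrib_left mult.assoc)

text \<open>Triangularity: \<open>U (Suc N)\<close> has exact degree \<open>Suc N\<close>, so
  subtracting a suitable multiple of it removes the top coefficient of \<open>p\<close>.\<close>

lemma poly_expansion_by_degrees:
  fixes p :: "'a :: field poly"
  assumes U: "\<And>n. U n \<noteq> 0 \<and> degree (U n) = n" and "degree p \<le> N"
  obtains c where "p = (\<Sum>k\<le>N. smult (c k) (U k))"
proof -
  have "\<exists>c. p = (\<Sum>k\<le>N. smult (c k) (U k))"
    using \<open>degree p \<le> N\<close>
  proof (induction N arbitrary: p)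
    case 0
    obtain x y where "p = [:x:]" "U 0 = [:y:]" "y \<noteq> 0"
      using 0 U[of 0] by (metis degree_eq_zeroE le_zero_eq pCons_0_0)
    thus ?case by (intro exI[of _ "\<lambda>_. x / y"]) simp
  next
    case (Suc N)
    define t where "t = coeff p (Suc N) / lead_coeff (U (Suc N))"
    have "degree (p - smult t (U (Suc N))) \<le> N"
    proof (rule degree_le, intro allI impI)
      fix i assume "N < i"
      thus "coeff (p - smult t (U (Suc N))) i = 0"
        using Suc.prems U[of "Suc N"] leading_coeff_neq_0[of "U (Suc N)"]
        by (cases "i = Suc N") (auto simp: t_def coeff_eq_0)
    qed
    then obtain c where "p - smult t (U (Suc N)) = (\<Sum>k\<le>N. smult (c k) (U k))"
      using Suc.IH by blast
    hence "p = (\<Sum>k\<le>Suc N. smult ((c(Suc N := t)) k) (U k))"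
      by (simp add: diff_eq_eq)
    thus ?case by blast
  qed
  thus ?thesis using that by blast
qed

lemma qpoch_Suc_shift: "qpoch z s (Suc n) = (1 - z) * qpoch (s * z) s n"
  unfolding qpoch_def by (subst prod.lessThan_Suc_shift) (simp add: ac_simps)

text \<open>From \<open>1 + u \<le> exp u\<close> and the geometric series. The bound is uniform in
  \<open>n\<close>; it controls both the infinite products near \<open>0\<close> and the finite
  products in the limit for the total mass.\<close>

lemma prod_one_plus_le_exp:
  fixes s t :: real
  assumes "0 \<le> t" "0 \<le> s" "s < 1"
  shows "(\<Prod>k<n. 1 + t * s ^ k) \<le> exp (t / (1 - s))"
proof -
  have "(\<Prod>k<n. 1 + t * s ^ k) \<le> exp (\<Sum>k<n. t * s ^ k)"
    using assms by (intro prod_le_exp_sum) auto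
  also have "\<dots> = exp (t * (\<Sum>k<n. s ^ k))"
    by (simp add: sum_distrib_left)
  also have "(\<Sum>k<n. s ^ k) \<le> 1 / (1 - s)"
    using sum_le_suminf[of "\<lambda>k. s ^ k" "{..<n}"] assms
    by (simp add: summable_geometric suminf_geometric)
  hence "exp (t * (\<Sum>k<n. s ^ k)) \<le> exp (t / (1 - s))"
    using mult_left_mono[of "\<Sum>k<n. s ^ k" "1 / (1 - s)" t] assms by simp
  finally show ?thesis .
qed

lemma choose_2_Suc: "Suc n choose 2 = (n choose 2) + n"
  by (simp add: numeral_2_eq_2)

lemma asc_coeff_0_0: "asc_coeff a r 0 0 = 1"
  by (simp add: asc_coeff_def qpoch_def numeral_2_eq_2)

lemma asc_coeff_Suc_0: "asc_coeff a r (Suc n) 0 = - (a * r ^ n * asc_coeff a r n 0)"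
  by (simp add: asc_coeff_def qpoch_def choose_2_Suc power_add)

section \<open>Infinite r-Pochhammer symbols\<close>

context
  fixes r :: complex
  assumes r0: "r \<noteq> 0" and r1: "norm r < 1"
begin

lemma qpoch_tendsto_qpoch_inf: "(\<lambda>n. qpoch z r n) \<longlonglongrightarrow> qpoch_inf z r"
proof -
  have "summable (\<lambda>k. norm (- (z * r ^ k)))"
    using r1 by (auto simp: norm_mult norm_power intro!: summable_mult summable_geometric)
  hence "convergent_prod (\<lambda>k. 1 - z * r ^ k)"
    using abs_convergent_prod_imp_convergent_prod[of "\<lambda>k. 1 - z * r ^ k"]
    by (auto simp: abs_convergent_prod_conv_summable)
  hence "(\<lambda>n. \<Prod>k\<le>n. 1 - z * r ^ k) \<longlonglongrightarrow> qpoch_inf z r"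
    unfolding qpoch_inf_def by (rule convergent_prod_LIMSEQ)
  hence "(\<lambda>n. qpoch z r (Suc n)) \<longlonglongrightarrow> qpoch_inf z r"
    by (simp add: qpoch_def lessThan_Suc_atMost del: prod.lessThan_Suc)
  thus ?thesis by (simp only: filterlim_sequentially_Suc)
qed

lemma qpoch_inf_shift: "qpoch_inf z r = (1 - z) * qpoch_inf (r * z) r"
proof (rule LIMSEQ_unique)
  show "(\<lambda>n. qpoch z r (Suc n)) \<longlonglongrightarrow> qpoch_inf z r"
    using qpoch_tendsto_qpoch_inf by (simp only: filterlim_sequentially_Suc)
  show "(\<lambda>n. qpoch z r (Suc n)) \<longlonglongrightarrow> (1 - z) * qpoch_inf (r * z) r"
    unfolding qpoch_Suc_shift by (intro tendsto_intros qpoch_tendsto_qpoch_inf)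
qed

lemma qpoch_inf_one [simp]: "qpoch_inf 1 r = 0"
  by (subst qpoch_inf_shift) simp

text \<open>Expanding the product bounds the distance to 1 by the same product taken with norms and
  plus signs. The bound tends to 0 with \<open>z\<close>, which yields continuity at
  \<open>0\<close>.\<close>

lemma norm_qpoch_inf_minus_one_le: "norm (qpoch_inf z r - 1) \<le> exp (norm z / (1 - norm r)) - 1"
proof (rule tendsto_upperbound)
  show "(\<lambda>n. norm (qpoch z r n - 1)) \<longlonglongrightarrow> norm (qpoch_inf z r - 1)"
    by (intro tendsto_intros qpoch_tendsto_qpoch_inf)
  have "norm (qpoch z r n - 1) \<le> exp (norm z / (1 - norm r)) - 1" for n
  proof -
    have "norm (qpoch z r n - 1) \<le> (\<Prod>k<n. 1 + norm z * norm r ^ k) - 1"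
      using norm_prod_minus1_le_prod_minus1[of "\<lambda>k. - (z * r ^ k)" "{..<n}"]
      by (simp add: qpoch_def norm_mult norm_power)
    also have "\<dots> \<le> exp (norm z / (1 - norm r)) - 1"
      using prod_one_plus_le_exp[of "norm z" "norm r" n] r1 by simp
    finally show ?thesis .
  qed
  thus "\<forall>\<^sub>F n in sequentially. norm (qpoch z r n - 1) \<le> exp (norm z / (1 - norm r)) - 1"
    by simp
qed simp

lemma qpoch_inf_0 [simp]: "qpoch_inf 0 r = 1"
  using norm_qpoch_inf_minus_one_le[of 0] by simp

lemma isCont_qpoch_inf_0: "isCont (\<lambda>z. qpoch_inf z r) 0"
proof -
  have "(norm \<longlongrightarrow> 0) (at (0::complex))"
    by (rule tendsto_norm_zero[OF tendsto_ident_at])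
  hence "((\<lambda>z::complex. exp (norm z / (1 - norm r)) - 1) \<longlongrightarrow> exp (0 / (1 - norm r)) - 1) (at 0)"
    using r1 by (intro tendsto_diff tendsto_exp tendsto_divide tendsto_const) auto
  hence "((\<lambda>z. qpoch_inf z r - 1) \<longlongrightarrow> 0) (at 0)"
    by (intro Lim_null_comparison[OF always_eventually[OF allI[OF norm_qpoch_inf_minus_one_le]]]) simp
  thus ?thesis unfolding isCont_def qpoch_inf_0 by (rule LIM_zero_cancel)
qed

lemma isCont_qpoch_inf_linear: "isCont (\<lambda>x. qpoch_inf (c * x / d) r) 0"
proof -
  have "isCont (\<lambda>x. c * x / d) 0"
    by (cases "d = 0") (auto intro: continuous_intros)
  moreover have "isCont (\<lambda>z. qpoch_inf z r) (c * 0 / d)"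
    using isCont_qpoch_inf_0 by simp
  ultimately show ?thesis by (rule isCont_o2)
qed

section \<open>Jackson integrals along a lattice\<close>

lemma lattice_tendsto_0: "(\<lambda>n. b * r ^ n) \<longlonglongrightarrow> 0"
  using tendsto_mult_right_zero[OF LIMSEQ_power_zero[OF r1], of b] by simp

lemma tendsto_lattice:
  assumes "isCont f (0::complex)"
  shows "(\<lambda>n. f (b * r ^ n)) \<longlonglongrightarrow> (f 0 :: complex)"
  by (rule isCont_tendsto_compose[OF assms lattice_tendsto_0])

lemma lattice_bounded:
  assumes "isCont f (0::complex)"
  obtains M where "M \<ge> 0" "\<And>n. norm (f (b * r ^ n) :: complex) \<le> M"
proof -
  have "Bseq (\<lambda>n. f (b * r ^ n))"
    using tendsto_lattice[OF assms] by (meson convergentI convergent_imp_Bseq)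
  thus ?thesis using that by (auto simp: Bseq_def intro: less_imp_le)
qed

text \<open>Continuity at the accumulation point \<open>0\<close> bounds \<open>f\<close> along the
  lattice, so a geometric series dominates. This is why continuity at \<open>0\<close> is the
  regularity condition in all linearity rules below.\<close>

lemma summable_jackson:
  assumes "isCont f 0"
  shows "summable (\<lambda>n. f (b * r ^ n) * r ^ n)"
proof -
  obtain M where M: "M \<ge> 0" "\<And>n. norm (f (b * r ^ n)) \<le> M"
    using lattice_bounded[OF assms] by metis
  show ?thesis
  proof (rule summable_comparison_test')
    show "summable (\<lambda>n. M * norm r ^ n)" using r1 by (intro summable_mult summable_geometric) simp
    show "norm (f (b * r ^ n) * r ^ n) \<le> M * norm r ^ n" for n
      unfolding norm_mult norm_power by (intro mult_right_mono M) auto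
  qed
qed

lemma jackson_integral0_add:
  assumes "isCont f 0" "isCont g 0"
  shows "jackson_integral0 r b (\<lambda>x. f x + g x) = jackson_integral0 r b f + jackson_integral0 r b g"
proof -
  have "(\<Sum>n. (f (b * r ^ n) + g (b * r ^ n)) * r ^ n) =
      (\<Sum>n. f (b * r ^ n) * r ^ n) + (\<Sum>n. g (b * r ^ n) * r ^ n)"
    using suminf_add[OF assms[THEN summable_jackson], of b b] by (simp add: distrib_right)
  thus ?thesis by (simp only: jackson_integral0_def distrib_left)
qed

lemma jackson_integral0_cmult:
  assumes "isCont f 0"
  shows "jackson_integral0 r b (\<lambda>x. c * f x) = c * jackson_integral0 r b f"
  using suminf_mult[OF assms[THEN summable_jackson], of c b]
  by (simp add: jackson_integral0_def algebra_simps)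

text \<open>The tail of the lattice \<open>b * r ^ n\<close> is again a lattice, started at
  \<open>b * r ^ k\<close>; the factor \<open>r ^ k\<close> of the weights moves into the
  endpoint.\<close>

lemma jackson_integral0_split:
  assumes "isCont f 0"
  shows "jackson_integral0 r b f =
           b * (1 - r) * (\<Sum>n<k. f (b * r ^ n) * r ^ n) + jackson_integral0 r (b * r ^ k) f"
proof -
  have "(\<Sum>n. f (b * r ^ n) * r ^ n) =
      (\<Sum>n. f (b * r ^ (n + k)) * r ^ (n + k)) + (\<Sum>n<k. f (b * r ^ n) * r ^ n)"
    by (rule suminf_split_initial_segment[OF summable_jackson[OF assms]])
  also have "(\<Sum>n. f (b * r ^ (n + k)) * r ^ (n + k)) = r ^ k * (\<Sum>n. f (b * r ^ k * r ^ n) * r ^ n)"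
    using suminf_mult[OF summable_jackson[OF assms], of "r ^ k" "b * r ^ k"]
    by (simp add: power_add mult_ac)
  finally show ?thesis by (simp add: jackson_integral0_def algebra_simps)
qed


section \<open>The weighted integral and its Pearson equation\<close>

context
  fixes a :: complex
  assumes a0: "a \<noteq> 0"
begin

lemma isCont_weight: "isCont (\<lambda>x. qpoch_inf (r * x) r * qpoch_inf (r * x / a) r) 0"
  using isCont_qpoch_inf_linear[of r 1] isCont_qpoch_inf_linear[of r a]
  by (auto intro!: continuous_mult)

lemma isCont_times_weight:
  "isCont f 0 \<Longrightarrow> isCont (\<lambda>x. f x * qpoch_inf (r * x) r * qpoch_inf (r * x / a) r) 0"
  using continuous_mult[OF _ isCont_weight, of f] by (simp add: mult.assoc)

lemma asc_integral_add:
  assumes "isCont f 0" "isCont g 0"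
  shows "asc_integral a r (\<lambda>x. f x + g x) = asc_integral a r f + asc_integral a r g"
  using assms[THEN isCont_times_weight]
  by (simp add: asc_integral_def jackson_integral_def distrib_right jackson_integral0_add)

lemma asc_integral_cmult:
  assumes "isCont f 0"
  shows "asc_integral a r (\<lambda>x. c * f x) = c * asc_integral a r f"
  using jackson_integral0_cmult[OF isCont_times_weight[OF assms], of _ c]
  by (simp add: asc_integral_def jackson_integral_def mult.assoc right_diff_distrib)

lemma asc_integral_sum:
  assumes "\<And>i. i \<in> A \<Longrightarrow> isCont (f i) 0"
  shows "asc_integral a r (\<lambda>x. \<Sum>i\<in>A. f i x) = (\<Sum>i\<in>A. asc_integral a r (f i))"
  using assms
proof (induction A rule: infinite_finite_induct)
  case (insert i A)
  then show ?case
    by (simp add: asc_integral_add continuous_sum)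
qed (simp_all add: asc_integral_def jackson_integral_def jackson_integral0_def)

text \<open>With \<open>W x = w(x/r)\<close>, the hypothesis on \<open>g\<close> reads
  \<open>x * g x * w x = f x * W x - f (r * x) * W (r * x)\<close>, which telescopes along each
  lattice. At the endpoints \<open>1\<close> and \<open>a\<close>, where \<open>W\<close> vanishes,
  both integrals equal \<open>- ((1 - r) * f 0)\<close> and cancel. Stating the hypothesis for
  \<open>x * g x\<close> avoids a division at \<open>0\<close>.\<close>

lemma asc_integral_pearson:
  assumes f: "isCont f 0"
    and g: "\<And>x. x * g x = (1 - x) * (1 - x / a) * f x - f (r * x)"
  shows "asc_integral a r g = 0"
proof -
  define W where "W = (\<lambda>x. qpoch_inf x r * qpoch_inf (x / a) r)"
  have W: "W x = (1 - x) * (1 - x / a) * W (r * x)" for x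
    using qpoch_inf_shift[of x] qpoch_inf_shift[of "x / a"] by (simp add: W_def)
  have "W 0 = 1" by (simp add: W_def)
  have "isCont W 0"
    unfolding W_def using isCont_qpoch_inf_0 isCont_qpoch_inf_linear[of 1 a]
    by (auto intro!: continuous_mult)
  hence fW: "isCont (\<lambda>x. f x * W x) 0"
    using f by (rule continuous_mult[rotated])
  have "jackson_integral0 r b (\<lambda>x. g x * qpoch_inf (r * x) r * qpoch_inf (r * x / a) r) =
          - ((1 - r) * f 0)" if "W b = 0" for b
  proof -
    have eq: "x * (g x * qpoch_inf (r * x) r * qpoch_inf (r * x / a) r) = f x * W x - f (r * x) * W (r * x)" for x
    proof -
      have "x * (g x * qpoch_inf (r * x) r * qpoch_inf (r * x / a) r) = (x * g x) * W (r * x)"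
        by (simp add: W_def mult.assoc)
      also have "\<dots> = f x * ((1 - x) * (1 - x / a) * W (r * x)) - f (r * x) * W (r * x)"
        unfolding g left_diff_distrib[of _ _ "W (r * x)"] by (simp only: mult_ac)
      finally show ?thesis by (simp only: W[of x])
    qed
    have "(\<lambda>n. f (b * r ^ n) * W (b * r ^ n) - f (b * r ^ Suc n) * W (b * r ^ Suc n)) sums
            (f (b * r ^ 0) * W (b * r ^ 0) - f 0 * W 0)"
      using tendsto_lattice[OF fW] by (rule telescope_sums')
    hence "(\<lambda>n. b * r ^ n * (g (b * r ^ n) * qpoch_inf (r * (b * r ^ n)) r * qpoch_inf (r * (b * r ^ n) / a) r))
            sums (- f 0)"
      using that \<open>W 0 = 1\<close> unfolding eq by (simp add: mult_ac)
    hence *: "(\<lambda>n. b * (g (b * r ^ n) * qpoch_inf (r * (b * r ^ n)) r * qpoch_inf (r * (b * r ^ n) / a) r * r ^ n))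
            sums (- f 0)"
      by (simp only: mult_ac)
    show ?thesis
    proof (cases "b = 0")
      \<comment> \<open>Impossible, since \<open>W 0 = 1\<close> while
        \<open>W b = 0\<close>.\<close>
      case True
      thus ?thesis using that by (simp add: W_def)
    next
      case False
      with * have "(\<lambda>n. g (b * r ^ n) * qpoch_inf (r * (b * r ^ n)) r * qpoch_inf (r * (b * r ^ n) / a) r * r ^ n)
         sums (- f 0 / b)"
        using sums_mult[OF *, of "1 / b"] by (simp add: field_simps)
      thus ?thesis using False by (simp add: jackson_integral0_def sums_iff)
    qed
  qed
  moreover have "W 1 = 0" "W a = 0" using a0 by (simp_all add: W_def)
  ultimately show ?thesis
    by (simp add: asc_integral_def jackson_integral_def)
qed

section \<open>Total mass\<close>

lemma asc_integral_prod_Suc: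
  "asc_integral a r (\<lambda>x. \<Prod>j<Suc N. x - a * r ^ j) = asc_integral a r (\<lambda>x. \<Prod>j<N. x - a * r ^ j)"
proof -
  define \<psi> where "\<psi> N x = (\<Prod>j<N. x - a * r ^ j)" for N x
  have cont: "isCont (\<psi> N) 0" for N
    unfolding \<psi>_def by (intro continuous_intros)
  have Suc: "\<psi> (Suc N) x = (x - a * r ^ N) * \<psi> N x" for x
    by (simp add: \<psi>_def mult.commute)
  \<comment> \<open>Dilation turns the factors \<open>x / r - a * r ^ j\<close> into those of index
    \<open>j + 1\<close>; the factor \<open>a - x\<close> restores index \<open>0\<close>, up to
    sign.\<close>
  have scale: "r ^ N * ((a - x) * \<psi> N (x / r)) = - \<psi> (Suc N) x" for x
  proof -
    have "r ^ N * \<psi> N (x / r) = (\<Prod>j<N. x - a * r ^ Suc j)"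
    proof -
      have "r ^ N * \<psi> N (x / r) = (\<Prod>j<N. r * (x / r - a * r ^ j))"
        by (simp add: \<psi>_def prod.distrib)
      also have "\<dots> = (\<Prod>j<N. x - a * r ^ Suc j)"
        using r0 by (intro prod.cong) (auto simp: field_simps)
      finally show ?thesis .
    qed
    thus ?thesis
      by (simp add: \<psi>_def prod.lessThan_Suc_shift del: prod.lessThan_Suc) (simp add: algebra_simps)
  qed
  have "asc_integral a r (\<lambda>x. \<psi> (Suc N) x + (- 1) * \<psi> N x) = 0"
  proof (rule asc_integral_pearson)
    \<comment> \<open>In this choice of \<open>f\<close>, \<open>a\<close> clears the denominator of
      \<open>1 - x / a\<close> and \<open>r ^ N\<close> is the power needed by
      \<open>scale\<close>.\<close>
    show "isCont (\<lambda>x. a * r ^ N * \<psi> N (x / r)) 0"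
      unfolding \<psi>_def using r0 by (intro continuous_intros) auto
    fix x
    have "(1 - x) * (1 - x / a) * (a * r ^ N * \<psi> N (x / r)) = (1 - x) * (r ^ N * ((a - x) * \<psi> N (x / r)))"
      using a0 by (simp add: field_simps)
    also have "\<dots> = - (1 - x) * ((x - a * r ^ N) * \<psi> N x)"
      unfolding scale Suc by (simp only: mult_minus_left mult_minus_right)
    finally have "(1 - x) * (1 - x / a) * (a * r ^ N * \<psi> N (x / r)) = - (1 - x) * ((x - a * r ^ N) * \<psi> N x)" .
    thus "x * (\<psi> (Suc N) x + (- 1) * \<psi> N x) =
      (1 - x) * (1 - x / a) * (a * r ^ N * \<psi> N (x / r)) - a * r ^ N * \<psi> N (r * x / r)"
      using r0 unfolding Suc by (simp add: ring_distribs)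
  qed
  also have "asc_integral a r (\<lambda>x. \<psi> (Suc N) x + (- 1) * \<psi> N x) =
      asc_integral a r (\<psi> (Suc N)) - asc_integral a r (\<psi> N)"
    by (subst asc_integral_add asc_integral_cmult; (intro continuous_intros cont)?)+ simp
  finally show ?thesis by (simp add: \<psi>_def[abs_def])
qed

text \<open>On the disc of radius \<open>norm r\<close>, factor \<open>j\<close> has norm at most
  \<open>norm r * (1 + norm a / norm r * norm r ^ j)\<close>. The product is therefore
  O(\<open>norm r ^ N\<close>) uniformly on the lattice, and so is the integral.\<close>

lemma jackson_integral0_prod_tendsto_0:
  assumes b: "norm b \<le> norm r"
  shows "(\<lambda>N. jackson_integral0 r b (\<lambda>x. (\<Prod>j<N. x - a * r ^ j) *
            qpoch_inf (r * x) r * qpoch_inf (r * x / a) r)) \<longlonglongrightarrow> 0"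
proof -
  define w where "w = (\<lambda>x. qpoch_inf (r * x) r * qpoch_inf (r * x / a) r)"
  define C where "C = exp (norm a / norm r / (1 - norm r))"
  obtain M where M: "M \<ge> 0" "\<And>n. norm (w (b * r ^ n)) \<le> M"
    using lattice_bounded[OF isCont_weight] unfolding w_def by metis
  have \<psi>: "norm (\<Prod>j<N. x - a * r ^ j) \<le> C * norm r ^ N" if "norm x \<le> norm r" for x N
  proof -
    have "norm (\<Prod>j<N. x - a * r ^ j) \<le> (\<Prod>j<N. norm r * (1 + norm a / norm r * norm r ^ j))"
      unfolding prod_norm[symmetric]
    proof (intro prod_mono conjI)
      fix j
      have "norm (x - a * r ^ j) \<le> norm x + norm (a * r ^ j)" by (rule norm_triangle_ineq4)
      also have "\<dots> \<le> norm r * (1 + norm a / norm r * norm r ^ j)"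
        using that r0 by (simp add: norm_mult norm_power distrib_left)
      finally show "norm (x - a * r ^ j) \<le> norm r * (1 + norm a / norm r * norm r ^ j)" .
    qed simp
    also have "\<dots> = (\<Prod>j<N. 1 + norm a / norm r * norm r ^ j) * norm r ^ N"
      by (simp add: prod.distrib)
    also have "\<dots> \<le> C * norm r ^ N"
      unfolding C_def using r1 by (intro mult_right_mono prod_one_plus_le_exp) auto
    finally show ?thesis .
  qed
  have bound: "norm (jackson_integral0 r b (\<lambda>x. (\<Prod>j<N. x - a * r ^ j) *
            qpoch_inf (r * x) r * qpoch_inf (r * x / a) r))
      \<le> norm (b * (1 - r)) * (C * M / (1 - norm r)) * norm r ^ N" for N
  proof -
    have "norm (\<Sum>n. (\<Prod>j<N. b * r ^ n - a * r ^ j) * w (b * r ^ n) * r ^ n)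
        \<le> (\<Sum>n. C * norm r ^ N * M * norm r ^ n)"
    proof (rule norm_suminf_le)
      fix n
      have "norm (b * r ^ n) \<le> norm r * 1"
        unfolding norm_mult norm_power using b r1 by (intro mult_mono power_le_one) auto
      hence "norm (\<Prod>j<N. b * r ^ n - a * r ^ j) \<le> C * norm r ^ N" by (intro \<psi>) simp
      thus "norm ((\<Prod>j<N. b * r ^ n - a * r ^ j) * w (b * r ^ n) * r ^ n) \<le> C * norm r ^ N * M * norm r ^ n"
        unfolding norm_mult norm_power
        by (intro mult_right_mono mult_mono M) (auto simp: C_def)
    qed (use r1 in \<open>intro summable_mult summable_geometric; simp\<close>)
    also have "\<dots> = C * M / (1 - norm r) * norm r ^ N"
      using r1 by (simp add: suminf_mult suminf_geometric summable_geometric)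
    finally have "norm (b * (1 - r)) * norm (\<Sum>n. (\<Prod>j<N. b * r ^ n - a * r ^ j) * w (b * r ^ n) * r ^ n)
       \<le> norm (b * (1 - r)) * (C * M / (1 - norm r) * norm r ^ N)"
      by (rule mult_left_mono) simp
    thus ?thesis
      by (simp add: jackson_integral0_def w_def norm_mult mult.assoc)
  qed
  have "(\<lambda>N. norm (b * (1 - r)) * (C * M / (1 - norm r)) * norm r ^ N) \<longlonglongrightarrow> 0"
    using r1 by (intro tendsto_mult_right_zero LIMSEQ_power_zero) simp
  thus ?thesis
    by (rule Lim_null_comparison[OF always_eventually[OF allI[OF bound]]])
qed

lemma asc_integral_1:
  "asc_integral a r (\<lambda>x. 1) =
     (1 - r) * qpoch_inf r r * qpoch_inf a r * qpoch_inf (r / a) r"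
proof -
  define w where "w x = qpoch_inf (r * x) r * qpoch_inf (r * x / a) r" for x
  define h where "h N = (\<lambda>x. (\<Prod>j<N. x - a * r ^ j) * qpoch_inf (r * x) r * qpoch_inf (r * x / a) r)" for N
  have cont: "isCont (h N) 0" for N
    unfolding h_def by (intro isCont_times_weight continuous_intros)
  have const: "asc_integral a r (\<lambda>x. \<Prod>j<N. x - a * r ^ j) = asc_integral a r (\<lambda>x. 1)" for N
    by (induction N) (simp_all add: asc_integral_prod_Suc del: prod.lessThan_Suc)
  have "(\<lambda>N. jackson_integral0 r 1 (h N)) \<longlonglongrightarrow> (1 - r) * (qpoch_inf a r * w 1)"
  proof -
    \<comment> \<open>Splitting off the single point \<open>x = 1\<close>, where the product is
      \<open>qpoch a r N\<close>, leaves the endpoint \<open>r\<close>, to which the decay estimate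
      applies.\<close>
    have "jackson_integral0 r 1 (h N) =
        (1 - r) * (qpoch a r N * w 1) + jackson_integral0 r r (h N)" for N
      using jackson_integral0_split[OF cont, of 1 N 1]
      by (simp add: h_def w_def qpoch_def mult.assoc)
    moreover have "(\<lambda>N. (1 - r) * (qpoch a r N * w 1) + jackson_integral0 r r (h N)) \<longlonglongrightarrow>
        (1 - r) * (qpoch_inf a r * w 1) + 0"
      using jackson_integral0_prod_tendsto_0[of r]
      by (intro tendsto_intros qpoch_tendsto_qpoch_inf) (simp_all add: h_def)
    ultimately show ?thesis by simp
  qed
  moreover have "(\<lambda>N. jackson_integral0 r a (h N)) \<longlonglongrightarrow> 0"
  proof -
    \<comment> \<open>The endpoint \<open>a\<close> may lie outside the disc of the decay estimate,
      but some \<open>a * r ^ k\<close> lies inside. Once \<open>N \<ge> k\<close>, the product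
      vanishes at the skipped points \<open>a * r ^ n\<close> with \<open>n < k\<close>.\<close>
    have "\<forall>\<^sub>F k in sequentially. norm (a * r ^ k) < norm r"
      using order_tendstoD(2)[OF tendsto_norm[OF lattice_tendsto_0[of a]], of "norm r"] r0 by simp
    then obtain k where k: "norm (a * r ^ k) < norm r"
      using eventually_happens'[OF sequentially_bot] by blast
    have eq: "jackson_integral0 r a (h N) = jackson_integral0 r (a * r ^ k) (h N)" if "N \<ge> k" for N
    proof -
      have "h N (a * r ^ n) = 0" if "n < k" for n
      proof -
        have "(\<Prod>j<N. a * r ^ n - a * r ^ j) = 0"
          using that \<open>N \<ge> k\<close> by (intro prod_zero bexI[of _ n]) auto
        thus ?thesis by (simp add: h_def)
      qed
      thus ?thesis by (subst jackson_integral0_split[OF cont, of a N k]) simp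
    qed
    have "(\<lambda>N. jackson_integral0 r (a * r ^ k) (h N)) \<longlonglongrightarrow> 0"
      unfolding h_def using k by (intro jackson_integral0_prod_tendsto_0) simp
    thus ?thesis
      by (rule Lim_transform_eventually)
         (rule eventually_mono[OF eventually_ge_at_top[of k]], simp add: eq)
  qed
  ultimately have "(\<lambda>N. jackson_integral0 r 1 (h N) - jackson_integral0 r a (h N)) \<longlonglongrightarrow>
      (1 - r) * (qpoch_inf a r * w 1) - 0"
    by (rule tendsto_diff)
  \<comment> \<open>By \<open>const\<close> the sequence is constant, so its limit is the total
    mass.\<close>
  moreover have "jackson_integral0 r 1 (h N) - jackson_integral0 r a (h N) = asc_integral a r (\<lambda>x. 1)" for N
    unfolding const[of N, symmetric] by (simp only: asc_integral_def jackson_integral_def h_def)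
  ultimately show ?thesis
    by (simp add: LIMSEQ_const_iff w_def mult_ac)
qed


section \<open>Recurrences for the expansion coefficients\<close>

lemma power_r_neq_1: "r ^ Suc k \<noteq> 1"
proof
  assume "r ^ Suc k = 1"
  hence "norm r ^ Suc k = 1" by (metis norm_one norm_power)
  thus False using r1 power_Suc_less_one[of "norm r" k] by (cases "norm r = 0") auto
qed

lemma qpoch_neq_0: "qpoch r r k \<noteq> 0"
  using power_r_neq_1 by (auto simp: qpoch_def)

text \<open>The factor of index \<open>n\<close> in the numerator Pochhammer symbol is
  \<open>1 - r^-n r^n = 0\<close>.\<close>

lemma asc_coeff_eq_0:
  assumes "n < k"
  shows "asc_coeff a r n k = 0"
proof -
  have "1 - r powi (- int n) * r ^ n = 0"
    using r0 by (simp add: power_int_minus)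
  hence "qpoch (r powi (- int n)) r k = 0"
    unfolding qpoch_def using assms by (intro prod_zero) auto
  thus ?thesis by (simp add: asc_coeff_def)
qed

text \<open>Splitting off the first factor of the numerator symbol shifts its base from
  \<open>r^-(n+1)\<close> to \<open>r^-n\<close>. This is the lowering relation for
  coefficients.\<close>

lemma asc_coeff_Suc_Suc:
  "(1 - r ^ Suc k) * asc_coeff a r (Suc n) (Suc k) = (1 - r ^ Suc n) * asc_coeff a r n k"
proof -
  define X where "X = r powi (- int (Suc n))"
  have X: "r ^ Suc n * X = 1" "r * X = r powi (- int n)"
    using r0 by (simp_all add: X_def power_int_minus field_simps del: of_nat_Suc)
  have q: "qpoch r r (Suc k) = qpoch r r k * (1 - r ^ Suc k)"
    by (simp add: qpoch_def)
  have "(1 - r ^ Suc k) * asc_coeff a r (Suc n) (Suc k) =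
     (- a) ^ n * r ^ (n choose 2) * (qpoch (r * X) r k / qpoch r r k * (r ^ k / a ^ k)) * (- (r ^ n * r * (1 - X)))"
    using a0 power_r_neq_1[of k] qpoch_neq_0[of k]
    unfolding asc_coeff_def X_def[symmetric] qpoch_Suc_shift[of X] q choose_2_Suc power_add
    by (simp add: divide_simps del: power_Suc) (simp add: mult_ac)
  also have "- (r ^ n * r * (1 - X)) = 1 - r ^ Suc n"
    using X(1) by (simp add: algebra_simps)
  finally show ?thesis unfolding X(2) asc_coeff_def[of a r n k] by (simp only: mult_ac)
qed

text \<open>Here the last factors of both Pochhammer symbols are split off, and \<open>r ^ n\<close>
  clears the negative power.\<close>

lemma asc_coeff_Suc_right:
  "r ^ n * a * (1 - r ^ Suc k) * asc_coeff a r n (Suc k) = r * (r ^ n - r ^ k) * asc_coeff a r n k"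
proof -
  define X where "X = r powi (- int n)"
  have X: "r ^ n * X = 1"
    using r0 by (simp_all add: X_def power_int_minus)
  have q: "qpoch r r (Suc k) = qpoch r r k * (1 - r ^ Suc k)" "qpoch X r (Suc k) = qpoch X r k * (1 - X * r ^ k)"
    by (simp_all add: qpoch_def)
  have "r ^ n * a * (1 - r ^ Suc k) * asc_coeff a r n (Suc k) =
     r * (r ^ n - (r ^ n * X) * r ^ k) * asc_coeff a r n k"
    using a0 power_r_neq_1[of k] qpoch_neq_0[of k]
    unfolding asc_coeff_def X_def[symmetric] q
    by (simp add: divide_simps del: power_Suc) (simp add: algebra_simps)
  thus ?thesis using X by simp
qed

text \<open>A q-Pascal rule, the coefficient form of the raising relation: it combines the two
  preceding recurrences, after which \<open>1 - r ^ Suc k\<close> cancels.\<close>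

lemma asc_coeff_pascal:
  "r ^ Suc k * asc_coeff a r (Suc n) (Suc k) =
     r ^ n * (r * asc_coeff a r n k - a * asc_coeff a r n (Suc k))"
proof -
  have "(1 - r ^ Suc k) * (r ^ Suc k * asc_coeff a r (Suc n) (Suc k)) =
      r ^ Suc k * ((1 - r ^ Suc n) * asc_coeff a r n k)"
    unfolding asc_coeff_Suc_Suc[symmetric] by (simp add: mult_ac)
  also have "\<dots> = r ^ n * (1 - r ^ Suc k) * r * asc_coeff a r n k - r * (r ^ n - r ^ k) * asc_coeff a r n k"
    by (simp add: algebra_simps)
  also have "\<dots> = (1 - r ^ Suc k) * (r ^ n * (r * asc_coeff a r n k - a * asc_coeff a r n (Suc k)))"
    unfolding asc_coeff_Suc_right[symmetric] by (simp add: algebra_simps)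
  finally show ?thesis using power_r_neq_1[of k] by simp
qed

lemma asc_coeff_self: "asc_coeff a r n n = 1"
proof (induction n)
  case (Suc n)
  thus ?case using asc_coeff_Suc_Suc[of n n] power_r_neq_1[of n] by simp
qed (rule asc_coeff_0_0)

text \<open>The Newton product of index \<open>k\<close> is monic of degree \<open>k\<close>, and
  the coefficient of the one of index \<open>n\<close> is 1 by
  \<open>asc_coeff_self\<close>.\<close>

lemma al_salam_carlitz_degree:
  "al_salam_carlitz a r n \<noteq> 0 \<and> degree (al_salam_carlitz a r n) = n"
proof -
  let ?\<phi> = "\<lambda>k. \<Prod>j<k. [:- (r ^ j), 1:]"
  have deg: "degree (?\<phi> k) = k" for k
    by (subst degree_prod_eq_sum_degree) auto
  have "lead_coeff (?\<phi> n) = 1"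
    by (simp add: lead_coeff_prod)
  hence lead: "coeff (?\<phi> n) n = 1" by (simp add: deg)
  have eq: "al_salam_carlitz a r n = (\<Sum>k\<le>n. smult (asc_coeff a r n k) (?\<phi> k))"
    by (rule poly_eqI)
       (simp add: al_salam_carlitz_def asc_coeff_def coeff_sum sum_distrib_left mult.assoc)
  have "coeff (al_salam_carlitz a r n) n = (\<Sum>k\<le>n. if k = n then 1 else 0)"
    unfolding eq coeff_sum
    by (intro sum.cong) (auto simp: lead asc_coeff_self coeff_eq_0 deg)
  hence "coeff (al_salam_carlitz a r n) n \<noteq> 0" by simp
  moreover have "degree (al_salam_carlitz a r n) \<le> n"
    unfolding eq by (rule degree_sum_le) (auto intro: order_trans[OF degree_smult_le] simp: deg)
  ultimately show ?thesis using le_degree[of "al_salam_carlitz a r n" n] by force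
qed

section \<open>Lowering and raising relations\<close>

lemma prod_shifted_dilate:
  "(\<Prod>j<Suc k. r * x - r ^ j) = (r * x - 1) * r ^ k * (\<Prod>j<k. x - r ^ j)"
proof -
  have "(\<Prod>j<k. r * x - r ^ Suc j) = (\<Prod>j<k. r * (x - r ^ j))"
    by (simp add: right_diff_distrib)
  thus ?thesis
    unfolding prod.lessThan_Suc_shift by (simp add: prod.distrib mult.assoc)
qed

text \<open>The r-difference of the Newton product of index \<open>k + 1\<close> is
  \<open>(1 - r ^ Suc k) * x\<close> times that of index \<open>k\<close>, and constants drop out;
  \<open>asc_coeff_Suc_Suc\<close> then changes the coefficients into those of
  \<open>U_n\<close>.\<close>

lemma al_salam_carlitz_lowering:
  "poly (al_salam_carlitz a r (Suc n)) x - poly (al_salam_carlitz a r (Suc n)) (r * x) =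
     (1 - r ^ Suc n) * x * poly (al_salam_carlitz a r n) x"
proof -
  have \<phi>: "(\<Prod>j<Suc k. x - r ^ j) - (\<Prod>j<Suc k. r * x - r ^ j) = (1 - r ^ Suc k) * x * (\<Prod>j<k. x - r ^ j)" for k
    unfolding prod_shifted_dilate by (simp add: algebra_simps)
  have "poly (al_salam_carlitz a r (Suc n)) x - poly (al_salam_carlitz a r (Suc n)) (r * x) =
      (\<Sum>k\<le>n. asc_coeff a r (Suc n) (Suc k) * ((\<Prod>j<Suc k. x - r ^ j) - (\<Prod>j<Suc k. r * x - r ^ j)))"
    unfolding poly_al_salam_carlitz sum.atMost_Suc_shift
    by (simp add: sum_subtractf right_diff_distrib del: prod.lessThan_Suc)
  also have "\<dots> = (\<Sum>k\<le>n. ((1 - r ^ Suc k) * asc_coeff a r (Suc n) (Suc k)) * (x * (\<Prod>j<k. x - r ^ j)))"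
    unfolding \<phi> by (simp only: mult_ac)
  also have "\<dots> = (1 - r ^ Suc n) * x * poly (al_salam_carlitz a r n) x"
    unfolding asc_coeff_Suc_Suc poly_al_salam_carlitz sum_distrib_left by (simp only: mult_ac)
  finally show ?thesis .
qed

text \<open>Everything is expressed through \<open>u x\<close> and the auxiliary sum
  \<open>S\<close>: \<open>(1 - x) * u (x / r) = u x - x * S\<close>, and
  \<open>U_(n+1)(x) = r ^ n * ((x - a) * S - u x)\<close>. Eliminating \<open>S\<close> gives the
  claim.\<close>

lemma al_salam_carlitz_raising:
  "(1 - x) * (a - x) * poly (al_salam_carlitz a r n) (x / r) =
     a * poly (al_salam_carlitz a r n) x + x * poly (al_salam_carlitz a r (Suc n)) x / r ^ n"
proof -
  define \<phi> where "\<phi> k y = (\<Prod>j<k. y - r ^ j)" for k y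
  define c where "c = asc_coeff a r n"
  define u where "u y = poly (al_salam_carlitz a r n) y" for y
  define S where "S = (\<Sum>k\<le>n. c k / r ^ k * \<phi> k x)"
  have u: "u y = (\<Sum>k\<le>n. c k * \<phi> k y)" for y
    by (simp add: u_def c_def \<phi>_def poly_al_salam_carlitz)
  have \<phi>_Suc: "\<phi> (Suc k) x = (x - r ^ k) * \<phi> k x" for k
    by (simp add: \<phi>_def mult.commute)
  have scale: "(1 - x) * (c k * \<phi> k (x / r)) = c k * \<phi> k x - x * (c k / r ^ k * \<phi> k x)" for k
  proof -
    have dil: "(x - 1) * r ^ k * \<phi> k (x / r) = (x - r ^ k) * \<phi> k x"
      using prod_shifted_dilate[of "x / r" k] r0 unfolding \<phi>_Suc[symmetric] by (simp add: \<phi>_def)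
    have "(1 - x) * (c k * \<phi> k (x / r)) = - (c k / r ^ k) * ((x - 1) * r ^ k * \<phi> k (x / r))"
      using r0 by (simp add: field_simps)
    also have "\<dots> = c k * \<phi> k x - x * (c k / r ^ k * \<phi> k x)"
      unfolding dil using r0 by (simp add: field_simps)
    finally show ?thesis .
  qed
  have dil: "(1 - x) * u (x / r) = u x - x * S"
    unfolding u S_def sum_distrib_left scale by (rule sum_subtractf)
  have coeff: "asc_coeff a r (Suc n) (Suc k) = r ^ n * (c k / r ^ k - a * (c (Suc k) / r ^ Suc k))" for k
    using asc_coeff_pascal[of k n] r0 by (simp add: c_def field_simps)
  have "poly (al_salam_carlitz a r (Suc n)) x =
      asc_coeff a r (Suc n) 0 + (\<Sum>k\<le>n. asc_coeff a r (Suc n) (Suc k) * \<phi> (Suc k) x)"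
    unfolding poly_al_salam_carlitz sum.atMost_Suc_shift \<phi>_def by simp
  also have "(\<Sum>k\<le>n. asc_coeff a r (Suc n) (Suc k) * \<phi> (Suc k) x) =
      r ^ n * ((\<Sum>k\<le>n. c k / r ^ k * \<phi> (Suc k) x) - a * (\<Sum>k\<le>n. c (Suc k) / r ^ Suc k * \<phi> (Suc k) x))"
    unfolding coeff sum_distrib_left sum_subtractf[symmetric]
    by (simp only: left_diff_distrib right_diff_distrib mult_ac)
  also have "(\<Sum>k\<le>n. c k / r ^ k * \<phi> (Suc k) x) = x * S - u x"
    using r0 unfolding \<phi>_Suc u S_def sum_distrib_left sum_subtractf[symmetric]
    by (intro sum.cong) (simp_all add: field_simps)
  also have "(\<Sum>k\<le>n. c (Suc k) / r ^ Suc k * \<phi> (Suc k) x) = S - c 0"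
  proof -
    \<comment> \<open>The added term is zero, as \<open>c (Suc n) = 0\<close>; the longer range
      permits the index shift.\<close>
    have "S = (\<Sum>k\<le>Suc n. c k / r ^ k * \<phi> k x)"
      by (simp add: S_def c_def asc_coeff_eq_0)
    thus ?thesis
      unfolding sum.atMost_Suc_shift by (simp add: \<phi>_def)
  qed
  \<comment> \<open>The constant term \<open>- (a * r ^ n * c 0)\<close> cancels the
    \<open>c 0\<close> left over from the shifted sum.\<close>
  finally have "poly (al_salam_carlitz a r (Suc n)) x = r ^ n * ((x - a) * S - u x)"
    unfolding asc_coeff_Suc_0 by (simp add: c_def algebra_simps)
  hence raise: "x * ((x - a) * S - u x) = x * poly (al_salam_carlitz a r (Suc n)) x / r ^ n"
    using r0 by simp
  have "(1 - x) * (a - x) * u (x / r) = (a - x) * ((1 - x) * u (x / r))"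
    by (simp only: mult_ac)
  also have "\<dots> = a * u x + x * ((x - a) * S - u x)"
    unfolding dil by (simp add: algebra_simps)
  finally show ?thesis unfolding raise unfolding u_def .
qed

section \<open>Orthogonality relation\<close>

text \<open>\<open>U_n\<close> is lowered to \<open>t v\<close> rather than to a multiple of \<open>U_(n-1)\<close> so that \<open>n = 0\<close>, with
  \<open>v = 0\<close>, is covered as well.\<close>

lemma asc_integral_al_salam_carlitz_rec:
  assumes "\<And>x. poly (al_salam_carlitz a r n) x - poly (al_salam_carlitz a r n) (r * x) = t * x * v x"
    and v: "isCont v 0"
  shows "asc_integral a r (\<lambda>x. poly (al_salam_carlitz a r n) x * poly (al_salam_carlitz a r (Suc m)) x) =
     - (a * r ^ m * t) * asc_integral a r (\<lambda>x. v x * poly (al_salam_carlitz a r m) x)"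
proof -
  define u where "u n = poly (al_salam_carlitz a r n)" for n
  have cont: "isCont (u n) 0" for n by (simp add: u_def)
  have "asc_integral a r (\<lambda>x. u n x * u (Suc m) x + a * r ^ m * t * (v x * u m x)) = 0"
  proof (rule asc_integral_pearson)
    \<comment> \<open>The constant \<open>a * r ^ m\<close> clears the denominators of
      \<open>1 - x / a\<close> and of the raising relation.\<close>
    show "isCont (\<lambda>x. a * r ^ m * (u n x * u m (x / r))) 0"
      unfolding u_def using r0 by (intro continuous_intros) auto
    fix x
    have low: "u n (r * x) = u n x - t * x * v x"
      using assms(1)[of x] by (simp add: u_def algebra_simps)
    have "(1 - x) * (1 - x / a) * (a * r ^ m * (u n x * u m (x / r))) =
        r ^ m * u n x * ((1 - x) * (a - x) * u m (x / r))"
      using a0 by (simp add: field_simps)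
    also have "\<dots> = u n x * (a * r ^ m * u m x + x * u (Suc m) x)"
      unfolding u_def al_salam_carlitz_raising using r0 by (simp add: field_simps)
    finally have *: "(1 - x) * (1 - x / a) * (a * r ^ m * (u n x * u m (x / r))) =
        u n x * (a * r ^ m * u m x + x * u (Suc m) x)" .
    show "x * (u n x * u (Suc m) x + a * r ^ m * t * (v x * u m x)) =
      (1 - x) * (1 - x / a) * (a * r ^ m * (u n x * u m (x / r))) -
      a * r ^ m * (u n (r * x) * u m (r * x / r))"
      unfolding * low using r0 by (simp add: algebra_simps)
  qed
  also have "asc_integral a r (\<lambda>x. u n x * u (Suc m) x + a * r ^ m * t * (v x * u m x)) =
      asc_integral a r (\<lambda>x. u n x * u (Suc m) x) + a * r ^ m * t * asc_integral a r (\<lambda>x. v x * u m x)"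
    using asc_integral_add[of "\<lambda>x. u n x * u (Suc m) x" "\<lambda>x. a * r ^ m * t * (v x * u m x)"]
      asc_integral_cmult[of "\<lambda>x. v x * u m x" "a * r ^ m * t"] cont v
    by simp
  finally show ?thesis by (simp add: u_def add_eq_0_iff2)
qed

lemma asc_integral_al_salam_carlitz:
  "asc_integral a r (\<lambda>x. poly (al_salam_carlitz a r n) x * poly (al_salam_carlitz a r m) x) =
     (- a) ^ n * (1 - r) * qpoch r r n * qpoch_inf r r * qpoch_inf a r * qpoch_inf (r / a) r *
     r ^ (n choose 2) * (if m = n then 1 else 0)"
proof -
  define I where "I n m = asc_integral a r (\<lambda>x. poly (al_salam_carlitz a r n) x * poly (al_salam_carlitz a r m) x)" for n m
  have sym: "I n m = I m n" for n m by (simp add: I_def mult.commute)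
  have one: "al_salam_carlitz a r 0 = 1"
    by (simp add: al_salam_carlitz_def qpoch_def numeral_2_eq_2)
  have I_0_Suc: "I 0 (Suc m) = 0" for m
    using asc_integral_al_salam_carlitz_rec[of 0 0 "\<lambda>_. 0" m] by (simp add: I_def one)
  have I_Suc_Suc: "I (Suc n) (Suc m) = - (a * r ^ m * (1 - r ^ Suc n)) * I n m" for n m
    unfolding I_def
    by (rule asc_integral_al_salam_carlitz_rec[OF al_salam_carlitz_lowering]) simp
  have "I n m = (- a) ^ n * (1 - r) * qpoch r r n * qpoch_inf r r * qpoch_inf a r * qpoch_inf (r / a) r *
     r ^ (n choose 2) * (if m = n then 1 else 0)"
  proof (induction n arbitrary: m)
    case 0
    show ?case
    proof (cases m)
      case 0
      thus ?thesis using asc_integral_1 by (simp add: I_def one qpoch_def numeral_2_eq_2)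
    qed (simp add: I_0_Suc)
  next
    case (Suc n)
    show ?case
    proof (cases m)
      case 0
      thus ?thesis by (simp add: sym[of "Suc n" 0] I_0_Suc)
    next
      case (Suc k)
      have "qpoch r r (Suc n) = qpoch r r n * (1 - r ^ Suc n)" by (simp add: qpoch_def)
      \<comment> \<open>The recursion contributes \<open>r ^ k\<close>, the claim needs
        \<open>r ^ n\<close>; they agree wherever the Kronecker delta is nonzero.\<close>
      thus ?thesis
        unfolding Suc I_Suc_Suc Suc.IH choose_2_Suc power_add by simp
    qed
  qed
  thus ?thesis by (simp add: I_def)
qed

section \<open>The pairing and uniqueness\<close>

lemma asc_pairing_eq: "asc_pairing a r f g = asc_integral a r (\<lambda>x. poly f x * poly g x)"
  by (simp add: asc_pairing_def asc_integral_def)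

lemma asc_pairing_commute: "asc_pairing a r f g = asc_pairing a r g f"
  by (simp add: asc_pairing_eq mult.commute)

lemma asc_pairing_sum_left:
  "asc_pairing a r (\<Sum>k\<in>A. smult (c k) (p k)) g = (\<Sum>k\<in>A. c k * asc_pairing a r (p k) g)"
  unfolding asc_pairing_eq poly_sum sum_distrib_right
  by (subst asc_integral_sum; simp add: mult.assoc asc_integral_cmult)

text \<open>Strong induction: \<open>P n\<close> is expanded in the \<open>U k\<close>, and pairing
  it with \<open>P m\<close>, already a nonzero multiple of \<open>U m\<close> for
  \<open>m < n\<close>, isolates the coefficient \<open>c m\<close>. Nonzero square norms
  \<open>h m\<close> force it to vanish.\<close>

lemma asc_orthogonal_unique:
  assumes P: "asc_orthogonal a r P"
  shows "\<exists>c. c \<noteq> 0 \<and> P n = smult c (al_salam_carlitz a r n)"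
proof -
  define U where "U = al_salam_carlitz a r"
  define \<kappa> where "\<kappa> = qpoch_inf r r * qpoch_inf a r * qpoch_inf (r / a) r"
  define h where "h n = (- a) ^ n * (1 - r) * qpoch r r n * \<kappa> * r ^ (n choose 2)" for n
  have U: "U n \<noteq> 0 \<and> degree (U n) = n" for n
    unfolding U_def by (rule al_salam_carlitz_degree)
  have UU: "asc_pairing a r (U n) (U m) = (if m = n then h n else 0)" for n m
    unfolding asc_pairing_eq U_def asc_integral_al_salam_carlitz h_def \<kappa>_def by (simp add: mult.assoc)
  have "\<kappa> \<noteq> 0"
  proof
    assume "\<kappa> = 0"
    hence zero: "asc_pairing a r (U n) (U m) = 0" for n m by (simp add: UU h_def)
    \<comment> \<open>Applied twice, in the left argument and, by symmetry, in the right one, this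
      makes the whole pairing zero, against the nondegeneracy clause of
      \<open>asc_orthogonal\<close>.\<close>
    have span: "asc_pairing a r p g = 0" if "\<And>k. asc_pairing a r (U k) g = 0" for p g
    proof -
      obtain c where c: "p = (\<Sum>k\<le>degree p. smult (c k) (U k))"
        using poly_expansion_by_degrees[OF U order_refl] .
      show ?thesis
        using arg_cong[OF c, of "\<lambda>p. asc_pairing a r p g"] that by (simp add: asc_pairing_sum_left)
    qed
    have "asc_pairing a r p (U m) = 0" for p m
      by (rule span) (rule zero)
    hence "asc_pairing a r p g = 0" for p g
      using span[of g p] by (simp add: asc_pairing_commute[of "U _" g])
    thus False using P by (simp add: asc_orthogonal_def)
  qed
  hence h: "h n \<noteq> 0" for n
    using a0 r0 qpoch_neq_0 power_r_neq_1[of 0] by (simp add: h_def)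
  show ?thesis
  proof (induction n rule: less_induct)
    case (less n)
    have Pn: "P n \<noteq> 0" "degree (P n) \<le> n" and orth: "m \<noteq> n \<Longrightarrow> asc_pairing a r (P m) (P n) = 0" for m
      using P by (auto simp: asc_orthogonal_def)
    obtain c where c: "P n = (\<Sum>k\<le>n. smult (c k) (U k))"
      using poly_expansion_by_degrees[OF U Pn(2)] .
    have "c m = 0" if "m < n" for m
    proof -
      obtain d where d: "d \<noteq> 0" "P m = smult d (U m)"
        using less.IH[OF \<open>m < n\<close>] by (auto simp: U_def)
      have "0 = asc_pairing a r (P m) (P n)" using orth that by simp
      also have "\<dots> = d * asc_pairing a r (P n) (U m)"
        \<comment> \<open>Homogeneity is obtained as linearity over a one-element index set.\<close>
        using asc_pairing_sum_left[of "\<lambda>_. d" "\<lambda>_. U m" "{0::nat}"]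
        by (simp add: d(2) asc_pairing_commute)
      also have "asc_pairing a r (P n) (U m) = (\<Sum>k\<le>n. c k * (if m = k then h k else 0))"
        unfolding c asc_pairing_sum_left UU by simp
      also have "\<dots> = c m * h m"
        using that by (simp add: if_distrib[of "(*) _"] sum.delta' cong: if_cong)
      finally show ?thesis using d(1) h by simp
    qed
    hence "(\<Sum>k<n. smult (c k) (U k)) = 0"
      by (intro sum.neutral) simp
    hence "P n = smult (c n) (U n)"
      unfolding c by (simp flip: lessThan_Suc_atMost)
    thus ?case using Pn(1) by (auto simp: U_def)
  qed
qed

end

end

theorem theorem1p2:
  fixes a q :: complex
  assumes "a \<noteq> 0" and "a \<noteq> 1" and "norm q > 1"
  shows "(\<forall>n. al_salam_carlitz a (inverse q) n \<noteq> 0 \<and>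
              degree (al_salam_carlitz a (inverse q) n) = n) \<and>
         (\<forall>n m. jackson_integral (inverse q) a 1
              (\<lambda>x. poly (al_salam_carlitz a (inverse q) n) x *
                   poly (al_salam_carlitz a (inverse q) m) x *
                   qpoch_inf (inverse q * x) (inverse q) *
                   qpoch_inf (inverse q * x / a) (inverse q)) =
            (- a) ^ n * (1 - inverse q) * qpoch (inverse q) (inverse q) n *
              qpoch_inf (inverse q) (inverse q) * qpoch_inf a (inverse q) *
              qpoch_inf (inverse q / a) (inverse q) * q powi (- int (n choose 2)) *
              (if m = n then 1 else 0)) \<and>
         (\<forall>P. asc_orthogonal a (inverse q) P \<longrightarrow>
            (\<forall>n. \<exists>c. c \<noteq> 0 \<and> P n = smult c (al_salam_carlitz a (inverse q) n)))"
proof -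
  define r where "r = inverse q"
  have r: "r \<noteq> 0" "norm r < 1"
    using assms(3) by (auto simp: r_def norm_inverse inverse_less_1_iff)
  have "q powi (- int (n choose 2)) = r ^ (n choose 2)" for n
    by (simp add: r_def power_int_minus power_inverse)
  thus ?thesis
    using al_salam_carlitz_degree[OF r assms(1)] asc_integral_al_salam_carlitz[OF r assms(1)]
      asc_orthogonal_unique[OF r assms(1)]
    by (simp add: r_def[symmetric] asc_integral_def)
qed

end
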